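(* If $x\in\mathbb{R}$ is not Martin-Löf random, then there is a weakly $L^1(\mathbb{R})$-computable $f\in L^1(\mathbb{R})$ such that $\lim_{y\to0^+}P[f](x,y)\neq f(x)$.
   Context: Randomness on $\mathbb{R}$ is with respect to Lebesgue measure $\lambda$. A Martin-Löf test is a sequence $\{V_k\}_k$ of uniformly effectively open ($\Sigma^0_1$) subsets of $\mathbb{R}$ with $\lambda(V_k)\le 2^{-k}$; $x$ is Martin-Löf random if $x\notin\bigcap_k V_k$ for every Martin-Löf test. A function $f\in L^1(\mathbb{R})$ is weakly $L^1(\mathbb{R})$-computable if there is a computable sequence $\{f_n\}_n$ of compactly supported continuous piecewise linear functions with rational vertices such that $f=\lim_n f_n$ (pointwise almost everywhere) and $\sum_n\|f_n-f_{n+1}\|_1<\infty$; the value $f(x)$ at a point is understood as $\lim_n f_n(x)$ (undefined if this limit does not exist, in which case the equality $\lim_{y\to0^+}P[f](x,y)=f(x)$ fails). The Poisson kernel is $P_y(s)=\frac{1}{\pi}\frac{y}{s^2+y^2}$ for $y>0$, and $P[f](x,y)=\int_{\mathbb{R}}P_y(x-t)f(t)\,dt$. *)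

theory Defs
  imports "HOL-Analysis.Analysis" "HOL-Library.Nat_Bijection"
begin

text \<open>
  Total recursive functions of arity \<open>n\<close> (Kleene, Shoenfield): minimization is applied to regular
  functions only. Functions of arity \<open>n\<close> are functions on lists, and only their values on
  lists of length \<open>n\<close> are meaningful.
\<close>

inductive recursive :: "nat \<Rightarrow> (nat list \<Rightarrow> nat) \<Rightarrow> bool" where
  zero: "recursive n (\<lambda>xs. 0)"
| succ: "recursive 1 (\<lambda>xs. Suc (hd xs))"
| proj: "i < n \<Longrightarrow> recursive n (\<lambda>xs. xs ! i)"
| comp: "recursive (length hs) g \<Longrightarrow> (\<forall>h\<in>set hs. recursive n h) \<Longrightarrow>
    recursive n (\<lambda>xs. g (map (\<lambda>h. h xs) hs))"
| prec: "recursive n g \<Longrightarrow> recursive (Suc (Suc n)) h \<Longrightarrow>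
    recursive (Suc n) (\<lambda>xs. rec_nat (g (tl xs)) (\<lambda>y r. h (y # r # tl xs)) (hd xs))"
| mini: "recursive (Suc n) g \<Longrightarrow> (\<forall>xs. length xs = n \<longrightarrow> (\<exists>y. g (y # xs) = 0)) \<Longrightarrow>
    recursive n (\<lambda>xs. LEAST y. g (y # xs) = 0)"

definition Sigma01 :: "nat \<Rightarrow> (nat list \<Rightarrow> bool) \<Rightarrow> bool" where
  "Sigma01 n R \<longleftrightarrow>
     (\<exists>g. recursive (Suc n) g \<and> (\<forall>xs. length xs = n \<longrightarrow> (R xs \<longleftrightarrow> (\<exists>m. g (m # xs) = 0))))"

definition rat_of_code :: "nat \<Rightarrow> real" where
  "rat_of_code n = (let (i, d) = prod_decode n in of_int (int_decode i) / of_nat (Suc d))"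

text \<open>
  Uniformly in \<open>k\<close>, the set \<open>V k\<close> is the union of a \<open>\<Sigma>\<^sup>0\<^sub>1\<close> family of
  open intervals with rational endpoints (empty if the endpoints are in the wrong order).
\<close>

definition uniformly_effectively_open :: "(nat \<Rightarrow> real set) \<Rightarrow> bool" where
  "uniformly_effectively_open V \<longleftrightarrow>
     (\<exists>R. Sigma01 3 R \<and>
        (\<forall>k. V k = \<Union> {{rat_of_code i <..< rat_of_code j} | i j. R [k, i, j]}))"

definition martin_lof_test :: "(nat \<Rightarrow> real set) \<Rightarrow> bool" where
  "martin_lof_test V \<longleftrightarrow>
     uniformly_effectively_open V \<and> (\<forall>k. emeasure lebesgue (V k) \<le> ennreal ((1 / 2) ^ k))"

definition martin_lof_random :: "real \<Rightarrow> bool" where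
  "martin_lof_random x \<longleftrightarrow> (\<forall>V. martin_lof_test V \<longrightarrow> x \<notin> (\<Inter>k. V k))"

text \<open>
  The function interpolating linearly between consecutive vertices and vanishing outside their range.
  It is continuous and compactly supported for the vertex lists singled out by \<open>pl_vertices\<close>.
\<close>

fun pl_fun :: "(real \<times> real) list \<Rightarrow> real \<Rightarrow> real" where
  "pl_fun ((a, u) # (b, v) # ps) x =
     (if a \<le> x \<and> x \<le> b then u + (v - u) * (x - a) / (b - a) else pl_fun ((b, v) # ps) x)"
| "pl_fun _ x = 0"

definition pl_vertices :: "(real \<times> real) list \<Rightarrow> bool" where
  "pl_vertices ps \<longleftrightarrow>
     sorted_wrt (\<lambda>p q. fst p < fst q) ps \<and> (ps \<noteq> [] \<longrightarrow> snd (hd ps) = 0 \<and> snd (last ps) = 0)"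

definition vertices_of_code :: "nat \<Rightarrow> (real \<times> real) list" where
  "vertices_of_code c = map (map_prod rat_of_code rat_of_code \<circ> prod_decode) (list_decode c)"

definition computable_pl_sequence :: "(nat \<Rightarrow> real \<Rightarrow> real) \<Rightarrow> bool" where
  "computable_pl_sequence s \<longleftrightarrow>
     (\<exists>c. recursive 1 c \<and>
        (\<forall>n. pl_vertices (vertices_of_code (c [n])) \<and> s n = pl_fun (vertices_of_code (c [n]))))"

text \<open>
  A weakly \<open>L\<^sup>1\<close>-computable function \<open>f\<close> together with the sequence \<open>s\<close> witnessing this;
  the sequence is kept since it determines the point values of \<open>f\<close>.
\<close>

definition weakly_L1_computable_via :: "(nat \<Rightarrow> real \<Rightarrow> real) \<Rightarrow> (real \<Rightarrow> real) \<Rightarrow> bool" where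
  "weakly_L1_computable_via s f \<longleftrightarrow>
     integrable lebesgue f \<and>
     computable_pl_sequence s \<and>
     (AE t in lebesgue. (\<lambda>n. s n t) \<longlonglongrightarrow> f t) \<and>
     summable (\<lambda>n. LINT t|lebesgue. \<bar>s n t - s (Suc n) t\<bar>)"

definition poisson_kernel :: "real \<Rightarrow> real \<Rightarrow> real" where
  "poisson_kernel y s = 1 / pi * (y / (s\<^sup>2 + y\<^sup>2))"

definition poisson_integral :: "(real \<Rightarrow> real) \<Rightarrow> real \<Rightarrow> real \<Rightarrow> real" where
  "poisson_integral f x y = (LINT t|lebesgue. poisson_kernel y (x - t) * f t)"

end

theory Submission imports Defs begin

text \<open>
  The zero function works, with a badly chosen approximating sequence. A test \<open>V\<close> with
  \<open>x \<in> (\<Inter>k. V k)\<close> yields a Solovay test that \<open>x\<close> fails: for each \<open>k\<close>, the maximal dyadic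
  intervals that are seen to lie inside \<open>V k\<close> at the stage equal to their level are pairwise disjoint,
  decidable, and cover \<open>V k\<close>, so their total length over all \<open>k\<close> is at most 2. Let \<open>s n\<close> be a tent of
  height 1 over the \<open>n\<close>-th such interval. The norms of the \<open>s n\<close> are summable, so \<open>s n \<longlonglongrightarrow> 0\<close>
  almost everywhere by Borel--Cantelli and the Poisson integral of the limit vanishes, but
  \<open>s n x \<ge> 1 / 2\<close> infinitely often.
\<close>

section \<open>Closure properties of recursive functions\<close>

text \<open>
  Agreement on lists of length \<open>n\<close> only: composition and primitive recursion do not control the values
  of a recursive function on lists of the wrong length.
\<close>

definition computable :: "nat \<Rightarrow> (nat list \<Rightarrow> nat) \<Rightarrow> bool" where
  "computable n f \<longleftrightarrow> (\<exists>g. recursive n g \<and> (\<forall>xs. length xs = n \<longrightarrow> f xs = g xs))"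

definition decidable :: "nat \<Rightarrow> (nat list \<Rightarrow> bool) \<Rightarrow> bool" where
  "decidable n P \<longleftrightarrow> computable n (\<lambda>xs. if P xs then 0 else 1)"

lemma computable_recursive: "recursive n f \<Longrightarrow> computable n f"
  by (auto simp: computable_def)

lemma computable_cong:
  "computable n f \<Longrightarrow> (\<And>xs. length xs = n \<Longrightarrow> f xs = g xs) \<Longrightarrow> computable n g"
  unfolding computable_def by metis

lemma computable_nth: "i < n \<Longrightarrow> computable n (\<lambda>xs. xs ! i)"
  by (intro computable_recursive recursive.proj)

lemma computable_comp:
  assumes "computable (length hs) g" "\<forall>h\<in>set hs. computable n h"
  shows "computable n (\<lambda>xs. g (map (\<lambda>h. h xs) hs))"
proof -
  obtain g' where g': "recursive (length hs) g'" "\<And>xs. length xs = length hs \<Longrightarrow> g xs = g' xs"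
    using assms(1) unfolding computable_def by auto
  obtain F where F: "\<And>h. h \<in> set hs \<Longrightarrow> recursive n (F h)"
      "\<And>h xs. h \<in> set hs \<Longrightarrow> length xs = n \<Longrightarrow> h xs = F h xs"
    using assms(2) unfolding computable_def by metis
  have "recursive n (\<lambda>xs. g' (map (\<lambda>h. h xs) (map F hs)))"
    by (rule recursive.comp) (use g' F in auto)
  moreover have "g (map (\<lambda>h. h xs) hs) = g' (map (\<lambda>h. h xs) (map F hs))" if "length xs = n" for xs
  proof -
    have "map (\<lambda>h. h xs) hs = map (\<lambda>h. h xs) (map F hs)"
      using F(2) that by auto
    then show ?thesis
      using g'(2) by (metis length_map)
  qed
  ultimately show ?thesis
    unfolding computable_def by blast
qed

lemma computable_comp1:
  assumes "computable 1 g" "computable n f"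
  shows "computable n (\<lambda>xs. g [f xs])"
  using computable_comp[of "[f]" g n] assms by simp

lemma computable_comp3:
  assumes "computable 3 g" "computable n a" "computable n b" "computable n c"
  shows "computable n (\<lambda>xs. g [a xs, b xs, c xs])"
  using computable_comp[of "[a, b, c]" g n] assms by (simp add: eval_nat_numeral)

lemma computable_comp4:
  assumes "computable 4 g" "computable n a" "computable n b" "computable n c" "computable n d"
  shows "computable n (\<lambda>xs. g [a xs, b xs, c xs, d xs])"
  using computable_comp[of "[a, b, c, d]" g n] assms by (simp add: eval_nat_numeral)

lemma computable_Suc: "computable n f \<Longrightarrow> computable n (\<lambda>xs. Suc (f xs))"
  using computable_comp1[OF computable_recursive[OF recursive.succ]] by simp

lemma computable_const: "computable n (\<lambda>xs. c)"
  by (induction c) (auto intro: computable_Suc computable_recursive recursive.zero)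

text \<open>\<open>recursive.prec\<close> recurses on the head of its argument. Composing with
  \<open>f\<close> and all projections makes the number of steps an arbitrary computable value while
  \<open>xs\<close> survives as parameter.\<close>

lemma computable_rec_nat:
  assumes "computable n b" "computable (Suc (Suc n)) h" "computable n f"
  shows "computable n (\<lambda>xs. rec_nat (b xs) (\<lambda>y r. h (y # r # xs)) (f xs))"
proof -
  obtain b' where b': "recursive n b'" "\<And>xs. length xs = n \<Longrightarrow> b xs = b' xs"
    using assms(1) unfolding computable_def by auto
  obtain h' where h': "recursive (Suc (Suc n)) h'" "\<And>xs. length xs = Suc (Suc n) \<Longrightarrow> h xs = h' xs"
    using assms(2) unfolding computable_def by auto
  let ?G = "\<lambda>xs. rec_nat (b' (tl xs)) (\<lambda>y r. h' (y # r # tl xs)) (hd xs)"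
  let ?hs = "f # map (\<lambda>i xs. xs ! i) [0..<n]"
  have "computable (length ?hs) ?G"
    using computable_recursive[OF recursive.prec[OF b'(1) h'(1)]] by simp
  then have "computable n (\<lambda>xs. ?G (map (\<lambda>h. h xs) ?hs))"
    by (rule computable_comp) (auto intro: assms computable_nth)
  moreover have "?G (map (\<lambda>h. h xs) ?hs) = rec_nat (b xs) (\<lambda>y r. h (y # r # xs)) (f xs)"
    if "length xs = n" for xs
  proof -
    have "map ((\<lambda>h. h xs) \<circ> (\<lambda>i xs. xs ! i)) [0..<n] = xs"
      using that by (auto intro: nth_equalityI)
    then show ?thesis
      using that by (simp add: b'(2) h'(2))
  qed
  ultimately show ?thesis
    by (rule computable_cong)
qed

lemma computable_tl:
  assumes "computable n f"
  shows "computable (Suc n) (\<lambda>xs. f (tl xs))"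
proof -
  let ?hs = "map (\<lambda>i xs. xs ! Suc i) [0..<n]"
  have "computable (Suc n) (\<lambda>xs. f (map (\<lambda>h. h xs) ?hs))"
    by (rule computable_comp) (auto intro: assms computable_nth)
  moreover have "map (\<lambda>h. h xs) ?hs = tl xs" if "length xs = Suc n" for xs :: "nat list"
    using that by (auto intro!: nth_equalityI simp: nth_tl)
  ultimately show ?thesis
    by (elim computable_cong) simp
qed

section \<open>Arithmetic and decidable predicates\<close>

lemma computable_add:
  assumes "computable n f" "computable n g"
  shows "computable n (\<lambda>xs. f xs + g xs)"
proof -
  have "computable n (\<lambda>xs. rec_nat (g xs) (\<lambda>y r. (\<lambda>ys. Suc (ys ! 1)) (y # r # xs)) (f xs))"
    by (intro computable_rec_nat assms computable_Suc computable_nth) auto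
  moreover have "rec_nat b (\<lambda>y r. Suc r) a = a + b" for a b
    by (induction a) auto
  ultimately show ?thesis
    by simp
qed

lemma computable_mult:
  assumes "computable n f" "computable n g"
  shows "computable n (\<lambda>xs. f xs * g xs)"
proof -
  have "computable n (\<lambda>xs. rec_nat 0 (\<lambda>y r. (\<lambda>ys. ys ! 1 + g (tl (tl ys))) (y # r # xs)) (f xs))"
    by (intro computable_rec_nat assms computable_add computable_const computable_nth
        computable_tl[where f = "\<lambda>ys. g (tl ys)"] computable_tl[of n g]) auto
  moreover have "rec_nat 0 (\<lambda>y r. r + b) a = a * b" for a b
    by (induction a) auto
  ultimately show ?thesis
    by simp
qed

lemma computable_power2:
  assumes "computable n f"
  shows "computable n (\<lambda>xs. 2 ^ f xs)"
proof -
  have "computable n (\<lambda>xs. rec_nat 1 (\<lambda>y r. (\<lambda>ys. 2 * ys ! 1) (y # r # xs)) (f xs))"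
    by (intro computable_rec_nat assms computable_mult computable_const computable_nth) auto
  moreover have "rec_nat (Suc 0) (\<lambda>y r. 2 * r) a = 2 ^ a" for a
    by (induction a) auto
  ultimately show ?thesis
    by simp
qed

lemma computable_diff:
  assumes "computable n f" "computable n g"
  shows "computable n (\<lambda>xs. f xs - g xs)"
proof -
  have pred: "computable m (\<lambda>xs. h xs - 1)" if "computable m h" for m h
  proof -
    \<comment> \<open>Predecessor: the recursion returns the index of its last step and forgets the
      accumulator.\<close>
    have "computable m (\<lambda>xs. rec_nat 0 (\<lambda>y r. (\<lambda>ys. ys ! 0) (y # r # xs)) (h xs))"
      by (intro computable_rec_nat that computable_const computable_nth) auto
    moreover have "rec_nat 0 (\<lambda>y r. y) a = a - 1" for a :: nat
      by (cases a) auto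
    ultimately show ?thesis
      by simp
  qed
  have "computable n (\<lambda>xs. rec_nat (f xs) (\<lambda>y r. (\<lambda>ys. ys ! 1 - 1) (y # r # xs)) (g xs))"
    by (intro computable_rec_nat assms pred computable_nth) auto
  moreover have "rec_nat a (\<lambda>y r. r - 1) b = a - b" for a b :: nat
    by (induction b) auto
  ultimately show ?thesis
    by simp
qed

lemma computable_if:
  assumes "decidable n P" "computable n f" "computable n g"
  shows "computable n (\<lambda>xs. if P xs then f xs else g xs)"
proof -
  let ?c = "\<lambda>xs. if P xs then 0 else 1 :: nat"
  \<comment> \<open>Since 0 codes truth, \<open>1 - ?c xs\<close> switches on the first
    branch.\<close>
  have "computable n (\<lambda>xs. (1 - ?c xs) * f xs + ?c xs * g xs)"
    by (intro computable_add computable_mult computable_diff computable_const assms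
        assms(1)[unfolded decidable_def])
  then show ?thesis
    by (rule computable_cong) auto
qed

lemma decidable_le:
  assumes "computable n f" "computable n g"
  shows "decidable n (\<lambda>xs. f xs \<le> g xs)"
proof -
  \<comment> \<open>Truncated subtraction vanishes exactly when \<open>f xs \<le> g xs\<close>; the
    double complement flattens positive differences to 1.\<close>
  have "computable n (\<lambda>xs. 1 - (1 - (f xs - g xs)))"
    by (intro computable_diff computable_const assms)
  then show ?thesis
    unfolding decidable_def by (rule computable_cong) auto
qed

lemma decidable_not:
  assumes "decidable n P"
  shows "decidable n (\<lambda>xs. \<not> P xs)"
  unfolding decidable_def
  by (rule computable_cong[OF computable_if[OF assms computable_const[of n 1]
            computable_const[of n 0]]]) auto

lemma decidable_conj:
  assumes "decidable n P" "decidable n Q"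
  shows "decidable n (\<lambda>xs. P xs \<and> Q xs)"
  unfolding decidable_def
  by (rule computable_cong[OF computable_if[OF assms(1) assms(2)[unfolded decidable_def]
            computable_const[of n 1]]]) auto

lemma decidable_less:
  assumes "computable n f" "computable n g"
  shows "decidable n (\<lambda>xs. f xs < g xs)"
  using decidable_not[OF decidable_le[OF assms(2,1)]] by (simp add: not_le)

lemma decidable_eq:
  fixes f g :: "nat list \<Rightarrow> nat"
  assumes "computable n f" "computable n g"
  shows "decidable n (\<lambda>xs. f xs = g xs)"
  using decidable_conj[OF decidable_le[OF assms] decidable_le[OF assms(2,1)]]
  by (simp add: order_eq_iff)

text \<open>Bounded search by primitive recursion: the accumulator starts at 1 (false) and becomes 0
  for good once a witness occurs. \<open>?Q\<close> deletes the accumulator from the argument list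
  before \<open>P\<close> is tested.\<close>

lemma decidable_bex:
  assumes "decidable (Suc n) P" "computable n f"
  shows "decidable n (\<lambda>xs. \<exists>i<f xs. P (i # xs))"
proof -
  let ?Q = "\<lambda>ys. P (ys ! 0 # tl (tl ys))"
  let ?p = "\<lambda>ys. if P ys then 0 else 1 :: nat"
  let ?hs = "(\<lambda>ys. ys ! 0) # map (\<lambda>i ys. ys ! Suc (Suc i)) [0..<n]"
  have "computable (Suc (Suc n)) (\<lambda>ys. ?p (map (\<lambda>h. h ys) ?hs))"
    by (rule computable_comp) (use assms(1) in \<open>auto simp: decidable_def intro: computable_nth\<close>)
  moreover have "map (\<lambda>h. h ys) ?hs = ys ! 0 # tl (tl ys)" if "length ys = Suc (Suc n)" for ys :: "nat list"
    using that by (auto intro!: nth_equalityI simp: nth_tl nth_Cons split: nat.split)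
  ultimately have "decidable (Suc (Suc n)) ?Q"
    unfolding decidable_def by (elim computable_cong) metis
  then have "computable n (\<lambda>xs. rec_nat 1
      (\<lambda>y r. (\<lambda>ys. if ?Q ys then 0 else ys ! 1) (y # r # xs)) (f xs))"
    by (intro computable_rec_nat assms computable_if computable_const computable_nth) auto
  moreover have "rec_nat 1 (\<lambda>y r. if P (y # xs) then 0 else r) a
      = (if \<exists>i<a. P (i # xs) then 0 else 1 :: nat)" for a xs
    by (induction a) (auto simp: less_Suc_eq)
  ultimately show ?thesis
    unfolding decidable_def by (elim computable_cong) (simp cong: if_cong)
qed

lemma computable_Least:
  assumes "decidable (Suc n) P" "\<And>xs. length xs = n \<Longrightarrow> \<exists>y. P (y # xs)"
  shows "computable n (\<lambda>xs. LEAST y. P (y # xs))"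
proof -
  obtain g where g: "recursive (Suc n) g"
    "\<And>xs. length xs = Suc n \<Longrightarrow> (if P xs then 0 else 1) = g xs"
    using assms(1) unfolding computable_def decidable_def by auto
  have P: "g (y # xs) = 0 \<longleftrightarrow> P (y # xs)" if "length xs = n" for y xs
    using g(2)[of "y # xs"] that by (auto split: if_splits)
  have "recursive n (\<lambda>xs. LEAST y. g (y # xs) = 0)"
    by (rule recursive.mini[OF g(1)]) (use assms(2) P in auto)
  then show ?thesis
    by (rule computable_cong[OF computable_recursive]) (simp add: P)
qed

lemmas computable_intros = computable_const computable_nth computable_Suc computable_add
  computable_mult computable_power2 computable_diff computable_if
  decidable_le decidable_less decidable_eq decidable_not decidable_conj

section \<open>Coding of pairs and integers\<close>

lemma computable_div2:
  assumes "computable n f"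
  shows "computable n (\<lambda>xs. f xs div 2)"
proof -
  have "computable 1 (\<lambda>xs. LEAST y. (\<lambda>ys. ys ! 1 < 2 * ys ! 0 + 2) (y # xs))"
  proof (rule computable_Least)
    show "\<exists>y. (y # xs) ! 1 < 2 * (y # xs) ! 0 + 2" for xs :: "nat list"
      by (intro exI[of _ "xs ! 0"]) auto
  qed (intro computable_intros; simp)
  moreover have "(LEAST y. a < 2 * y + 2) = a div 2" for a :: nat
    by (rule Least_equality) auto
  ultimately have "computable 1 (\<lambda>xs. xs ! 0 div 2)"
    by simp
  from computable_comp1[OF this assms] show ?thesis
    by simp
qed

lemma computable_prod_encode:
  assumes "computable n f" "computable n g"
  shows "computable n (\<lambda>xs. prod_encode (f xs, g xs))"
proof -
  have "computable n (\<lambda>xs. (f xs + g xs) * Suc (f xs + g xs) div 2 + f xs)"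
    by (intro computable_intros computable_div2 assms)
  then show ?thesis
    by (simp add: prod_encode_def triangle_def)
qed

text \<open>The second component is at most the code, so a bounded search decides whether a given
  number is the first component; minimization then finds it.\<close>

lemma computable_fst_prod_decode:
  assumes "computable n f"
  shows "computable n (\<lambda>xs. fst (prod_decode (f xs)))"
proof -
  let ?P = "\<lambda>ys. \<exists>b<Suc (ys ! 1). (\<lambda>zs. prod_encode (zs ! 1, zs ! 0) = zs ! 2) (b # ys)"
  have ex: "?P (a # xs) \<longleftrightarrow> a = fst (prod_decode (xs ! 0))" for a xs
  proof
    assume "a = fst (prod_decode (xs ! 0))"
    then have "prod_encode (a, snd (prod_decode (xs ! 0))) = xs ! 0"
      by simp
    moreover from this have "snd (prod_decode (xs ! 0)) \<le> xs ! 0"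
      by (metis le_prod_encode_2)
    ultimately show "?P (a # xs)"
      by (intro exI[of _ "snd (prod_decode (xs ! 0))"]) (simp add: less_Suc_eq_le)
  next
    assume "?P (a # xs)"
    then obtain b where "prod_encode (a, b) = xs ! 0"
      by auto
    then show "a = fst (prod_decode (xs ! 0))"
      by (metis fst_conv prod_encode_inverse)
  qed
  have "decidable (Suc 1) ?P"
    by (intro decidable_bex computable_intros computable_prod_encode) auto
  then have "computable 1 (\<lambda>xs. LEAST y. ?P (y # xs))"
    by (rule computable_Least) (simp only: ex, blast)
  moreover have "(LEAST b. b = c) = c" for c :: nat
    by (rule Least_equality) auto
  ultimately have "computable 1 (\<lambda>xs. fst (prod_decode (xs ! 0)))"
    by (simp only: ex)
  from computable_comp1[OF this assms] show ?thesis
    by simp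
qed

lemma computable_snd_prod_decode:
  assumes "computable n f"
  shows "computable n (\<lambda>xs. snd (prod_decode (f xs)))"
proof -
  have "computable 1
    (\<lambda>xs. LEAST y. (\<lambda>ys. prod_encode (fst (prod_decode (ys ! 1)), ys ! 0) = ys ! 1) (y # xs))"
  proof (rule computable_Least)
    show "\<exists>y. (\<lambda>ys. prod_encode (fst (prod_decode (ys ! 1)), ys ! 0) = ys ! 1) (y # xs)" for xs
      by (intro exI[of _ "snd (prod_decode (xs ! 0))"]) simp
  qed (intro computable_intros computable_prod_encode computable_fst_prod_decode; simp)
  moreover have "prod_encode (fst (prod_decode c), b) = c \<longleftrightarrow> b = snd (prod_decode c)" for b c
    by (metis prod.collapse prod_decode_inverse prod_encode_inverse snd_conv)
  moreover have "(LEAST b. b = c) = c" for c :: nat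
    by (rule Least_equality) auto
  ultimately have "computable 1 (\<lambda>xs. snd (prod_decode (xs ! 0)))"
    by simp
  from computable_comp1[OF this assms] show ?thesis
    by simp
qed

text \<open>Even codes 2k stand for k, odd codes 2k+1 for -k-1. Recursive functions have natural
  values, so the positive and the negative part are computed separately.\<close>

lemma computable_nat_int_decode:
  assumes "computable n f"
  shows "computable n (\<lambda>xs. nat (int_decode (f xs)))"
proof -
  have "computable n (\<lambda>xs. if 2 * (f xs div 2) = f xs then f xs div 2 else 0)"
    by (intro computable_intros computable_div2 assms)
  then show ?thesis
    by (rule computable_cong) (auto simp: int_decode_def sum_decode_def dest: odd_pos)
qed

lemma computable_nat_uminus_int_decode:
  assumes "computable n f"
  shows "computable n (\<lambda>xs. nat (- int_decode (f xs)))"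
proof -
  have "computable n (\<lambda>xs. if 2 * (f xs div 2) = f xs then 0 else Suc (f xs div 2))"
    by (intro computable_intros computable_div2 assms)
  then show ?thesis
    by (rule computable_cong) (auto simp: int_decode_def sum_decode_def dest: odd_pos)
qed

lemma computable_int_encode_diff:
  assumes "computable n f" "computable n g"
  shows "computable n (\<lambda>xs. int_encode (int (f xs) - int (g xs)))"
proof -
  have "computable n (\<lambda>xs. if g xs \<le> f xs then 2 * (f xs - g xs) else Suc (2 * (g xs - f xs - 1)))"
    by (intro computable_intros assms)
  then show ?thesis
    by (rule computable_cong) (auto simp: int_encode_def sum_encode_def nat_diff_distrib')
qed

section \<open>Disjoint dyadic intervals exhausting a test\<close>

text \<open>
  The shift by \<open>N\<close> keeps indices in the natural numbers; only points \<open>t \<ge> - N\<close> are covered, which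
  suffices since \<open>N\<close> may depend on the given point.
\<close>

definition dyadic :: "nat \<Rightarrow> nat \<Rightarrow> nat \<Rightarrow> real set" where
  "dyadic N m z = {real z / 2 ^ m - real N ..< (real z + 1) / 2 ^ m - real N}"

text \<open>Splitting the numerator into positive and negative parts lets comparisons of rationals
  be rewritten over the natural numbers.\<close>

lemma rat_of_code_eq:
  "rat_of_code c =
     (real (nat (int_decode (fst (prod_decode c)))) - real (nat (- int_decode (fst (prod_decode c)))))
       / real (Suc (snd (prod_decode c)))"
  by (auto simp: rat_of_code_def split: prod.split)

text \<open>Multiplying by the positive factor \<open>d * 2 ^ m\<close> and moving negative terms to
  the other side leaves an inequality of natural numbers.\<close>

lemma decidable_rat_of_code_less:
  assumes "computable n c" "computable n a" "computable n m"
  shows "decidable n (\<lambda>xs. rat_of_code (c xs) < real (a xs) / 2 ^ m xs - real N)"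
proof -
  let ?u = "\<lambda>xs. nat (int_decode (fst (prod_decode (c xs))))"
  let ?v = "\<lambda>xs. nat (- int_decode (fst (prod_decode (c xs))))"
  let ?d = "\<lambda>xs. Suc (snd (prod_decode (c xs)))"
  have "decidable n (\<lambda>xs. ?u xs * 2 ^ m xs + N * 2 ^ m xs * ?d xs < a xs * ?d xs + ?v xs * 2 ^ m xs)"
    by (intro computable_intros computable_fst_prod_decode computable_snd_prod_decode
        computable_nat_int_decode computable_nat_uminus_int_decode assms)
  moreover have "u * 2 ^ m + N * 2 ^ m * d < a * d + v * 2 ^ m \<longleftrightarrow>
      (real u - real v) / real d < real a / 2 ^ m - real N" if "0 < d" for u v d a m
  proof -
    have "u * 2 ^ m + N * 2 ^ m * d < a * d + v * 2 ^ m \<longleftrightarrow>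
      real (u * 2 ^ m + N * 2 ^ m * d) < real (a * d + v * 2 ^ m)"
      by (rule of_nat_less_iff[symmetric])
    also have "\<dots> \<longleftrightarrow> (real u - real v) / real d < real a / 2 ^ m - real N"
      using that by (simp add: field_simps)
    finally show ?thesis .
  qed
  ultimately show ?thesis
    unfolding rat_of_code_eq by (simp del: of_nat_Suc mult_Suc_right)
qed

lemma decidable_less_rat_of_code:
  assumes "computable n c" "computable n a" "computable n m"
  shows "decidable n (\<lambda>xs. real (a xs) / 2 ^ m xs - real N < rat_of_code (c xs))"
proof -
  let ?u = "\<lambda>xs. nat (int_decode (fst (prod_decode (c xs))))"
  let ?v = "\<lambda>xs. nat (- int_decode (fst (prod_decode (c xs))))"
  let ?d = "\<lambda>xs. Suc (snd (prod_decode (c xs)))"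
  have "decidable n (\<lambda>xs. a xs * ?d xs + ?v xs * 2 ^ m xs < ?u xs * 2 ^ m xs + N * 2 ^ m xs * ?d xs)"
    by (intro computable_intros computable_fst_prod_decode computable_snd_prod_decode
        computable_nat_int_decode computable_nat_uminus_int_decode assms)
  moreover have "a * d + v * 2 ^ m < u * 2 ^ m + N * 2 ^ m * d \<longleftrightarrow>
      real a / 2 ^ m - real N < (real u - real v) / real d" if "0 < d" for u v d a m
  proof -
    have "a * d + v * 2 ^ m < u * 2 ^ m + N * 2 ^ m * d \<longleftrightarrow>
      real (a * d + v * 2 ^ m) < real (u * 2 ^ m + N * 2 ^ m * d)"
      by (rule of_nat_less_iff[symmetric])
    also have "\<dots> \<longleftrightarrow> real a / 2 ^ m - real N < (real u - real v) / real d"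
      using that by (simp add: field_simps)
    finally show ?thesis .
  qed
  ultimately show ?thesis
    unfolding rat_of_code_eq by (simp del: of_nat_Suc mult_Suc_right)
qed

text \<open>The level \<open>m\<close> is also the stage: it bounds the interval codes
  \<open>i\<close>, \<open>j\<close> and the witness \<open>w\<close> for the enumeration of that
  interval, which makes acceptance decidable.\<close>

definition accepted :: "(nat list \<Rightarrow> nat) \<Rightarrow> nat \<Rightarrow> nat \<Rightarrow> nat \<Rightarrow> nat \<Rightarrow> bool" where
  "accepted g N k m z \<longleftrightarrow> (\<exists>i<m. \<exists>j<m. \<exists>w<m. g [w, k, i, j] = 0 \<and>
     rat_of_code i < real z / 2 ^ m - real N \<and> real (Suc z) / 2 ^ m - real N < rat_of_code j)"

text \<open>
  Maximality: acceptance passes to subintervals, so it suffices to inspect the parent. At \<open>m = 0\<close>,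
  where \<open>m - 1 = m\<close>, nothing is accepted.
\<close>

definition selected :: "(nat list \<Rightarrow> nat) \<Rightarrow> nat \<Rightarrow> nat \<Rightarrow> nat \<Rightarrow> nat \<Rightarrow> bool" where
  "selected g N k m z \<longleftrightarrow> accepted g N k m z \<and> \<not> accepted g N k (m - 1) (z div 2)"

lemma decidable_accepted:
  assumes "computable 4 g" "computable n a" "computable n b" "computable n c"
  shows "decidable n (\<lambda>xs. accepted g N (a xs) (b xs) (c xs))"
proof -
  \<comment> \<open>With the three bound variables in front, \<open>ys\<close> is
    \<open>[w, j, i, k, m, z]\<close>.\<close>
  let ?body = "\<lambda>ys. g [ys ! 0, ys ! 3, ys ! 2, ys ! 1] = 0 \<and>
      rat_of_code (ys ! 2) < real (ys ! 5) / 2 ^ (ys ! 4) - real N \<and>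
      real (Suc (ys ! 5)) / 2 ^ (ys ! 4) - real N < rat_of_code (ys ! 1)"
  have "decidable (Suc (Suc (Suc 3))) ?body"
    by (intro computable_intros decidable_rat_of_code_less decidable_less_rat_of_code
        computable_comp4 assms(1)) auto
  then have "decidable (Suc (Suc 3)) (\<lambda>ys. \<exists>w<ys ! 3. ?body (w # ys))"
    by (rule decidable_bex) (intro computable_intros; simp)
  then have "decidable (Suc 3) (\<lambda>ys. \<exists>j<ys ! 2. (\<lambda>ys. \<exists>w<ys ! 3. ?body (w # ys)) (j # ys))"
    by (rule decidable_bex) (intro computable_intros; simp)
  then have "decidable 3 (\<lambda>ys. \<exists>i<ys ! 1. (\<lambda>ys. \<exists>j<ys ! 2.
      (\<lambda>ys. \<exists>w<ys ! 3. ?body (w # ys)) (j # ys)) (i # ys))"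
    by (rule decidable_bex) (intro computable_intros; simp)
  then have "decidable 3 (\<lambda>ys. accepted g N (ys ! 0) (ys ! 1) (ys ! 2))"
    by (simp add: accepted_def)
  from computable_comp3[OF this[unfolded decidable_def] assms(2-4)] show ?thesis
    by (simp add: decidable_def)
qed

lemma decidable_selected:
  assumes "computable 4 g" "computable n a" "computable n b" "computable n c"
  shows "decidable n (\<lambda>xs. selected g N (a xs) (b xs) (c xs))"
  unfolding selected_def
  by (intro computable_intros decidable_accepted computable_div2 assms)

text \<open>A half of the parent stays inside the rational interval that accepts the parent, and the
  next stage only loosens the search bounds.\<close>

lemma accepted_Suc:
  assumes "accepted g N k m (z div 2)"
  shows "accepted g N k (Suc m) z"
proof -
  have "2 * (z div 2) \<le> z" "Suc z \<le> 2 * Suc (z div 2)"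
    by auto
  then have *: "2 * real (z div 2) \<le> real z" "real (Suc z) \<le> 2 * real (Suc (z div 2))"
    by (metis of_nat_le_iff of_nat_mult of_nat_numeral)+
  have "real (z div 2) / 2 ^ m \<le> real z / 2 ^ Suc m"
    "real (Suc z) / 2 ^ Suc m \<le> real (Suc (z div 2)) / 2 ^ m"
    using * by (simp_all add: divide_simps del: of_nat_Suc)
  moreover obtain i j w where "i < m" "j < m" "w < m" "g [w, k, i, j] = 0"
    "rat_of_code i < real (z div 2) / 2 ^ m - real N"
    "real (Suc (z div 2)) / 2 ^ m - real N < rat_of_code j"
    using assms unfolding accepted_def by blast
  ultimately have "i < Suc m" "j < Suc m" "w < Suc m" "g [w, k, i, j] = 0"
    "rat_of_code i < real z / 2 ^ Suc m - real N"
    "real (Suc z) / 2 ^ Suc m - real N < rat_of_code j"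
    by linarith+
  then show ?thesis
    unfolding accepted_def by blast
qed

lemma accepted_mono:
  assumes "accepted g N k m (z div 2 ^ d)"
  shows "accepted g N k (m + d) z"
  using assms
proof (induction d arbitrary: z)
  case (Suc d)
  then have "accepted g N k (m + d) (z div 2)"
    by (simp add: div_mult2_eq)
  then show ?case
    using accepted_Suc by simp
qed simp

text \<open>Scaling by \<open>2 ^ m\<close> turns dyadic cells into unit cells, so that uniqueness
  and the passage to coarser cells become integer arithmetic.\<close>

lemma mem_dyadic_iff: "t \<in> dyadic N m z \<longleftrightarrow> \<lfloor>(t + real N) * 2 ^ m\<rfloor> = int z"
  unfolding dyadic_def floor_eq_iff by (auto simp: field_simps)

lemma mem_dyadic_div:
  assumes "t \<in> dyadic N (m + d) z"
  shows "t \<in> dyadic N m (z div 2 ^ d)"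
proof -
  have "\<lfloor>(t + real N) * 2 ^ m\<rfloor> = \<lfloor>(t + real N) * 2 ^ (m + d) / real_of_int (2 ^ d)\<rfloor>"
    by (simp add: power_add)
  also have "\<dots> = \<lfloor>(t + real N) * 2 ^ (m + d)\<rfloor> div 2 ^ d"
    by (rule floor_divide_real_eq_div) simp
  also have "\<dots> = int (z div 2 ^ d)"
    using assms by (simp add: mem_dyadic_iff zdiv_int)
  finally show ?thesis
    by (simp add: mem_dyadic_iff)
qed

text \<open>Cells of different levels sharing a point are nested. The parent of the finer one then
  lies inside the coarser one, so it inherits acceptance, against maximality.\<close>

lemma selected_unique:
  assumes "selected g N k m z" "selected g N k m' z'" "t \<in> dyadic N m z" "t \<in> dyadic N m' z'"
  shows "m = m' \<and> z = z'"
proof -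
  have False if "selected g N k m z" "selected g N k (m + Suc d) z'"
    "t \<in> dyadic N m z" "t \<in> dyadic N (m + Suc d) z'" for m d z z'
  proof -
    have "z = z' div 2 ^ Suc d"
      using mem_dyadic_div[OF that(4)] that(3) by (simp add: mem_dyadic_iff)
    then have "accepted g N k m (z' div 2 div 2 ^ d)"
      using that(1) by (simp add: selected_def div_mult2_eq)
    then have "accepted g N k (m + d) (z' div 2)"
      by (rule accepted_mono)
    with that(2) show False
      by (simp add: selected_def)
  qed
  then have "m = m'"
    using assms by (metis less_iff_Suc_add add_Suc_right linorder_neqE_nat)
  with assms(3,4) show ?thesis
    by (simp add: mem_dyadic_iff)
qed

text \<open>Among the cells containing \<open>t\<close>, the one of least accepted level is
  selected, because its parent is the cell of \<open>t\<close> one level up.\<close>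

lemma selected_cover:
  assumes "g [w, k, i, j] = 0" "t \<in> {rat_of_code i <..< rat_of_code j}" "0 \<le> t + real N"
  obtains m z where "selected g N k m z" "t \<in> dyadic N m z"
proof -
  define Z where "Z m = nat \<lfloor>(t + real N) * 2 ^ m\<rfloor>" for m
  have Z: "t \<in> dyadic N m (Z m)" for m
    using assms(3) by (simp add: mem_dyadic_iff Z_def)
  obtain m0 where m0: "(1 / 2) ^ m0 < min (t - rat_of_code i) (rat_of_code j - t)"
    using real_arch_pow_inv[of "min (t - rat_of_code i) (rat_of_code j - t)" "1 / 2"] assms(2) by auto
  \<comment> \<open>Beyond level \<open>m0\<close> the cell of \<open>t\<close> fits strictly
    between the two endpoints; the other summands push the stage above \<open>i\<close>,
    \<open>j\<close> and \<open>w\<close>.\<close>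
  define M where "M = m0 + i + j + w + 1"
  have "(1 / 2) ^ M \<le> (1 / 2 :: real) ^ m0"
    by (rule power_decreasing) (auto simp: M_def)
  then have "1 / 2 ^ M < t - rat_of_code i" "1 / 2 ^ M < rat_of_code j - t"
    using m0 by (auto simp: power_one_over)
  moreover have "real (Z M) / 2 ^ M - real N \<le> t" "t < real (Z M) / 2 ^ M + 1 / 2 ^ M - real N"
    using Z[of M] by (auto simp: dyadic_def add_divide_distrib)
  ultimately have "rat_of_code i < real (Z M) / 2 ^ M - real N"
    "real (Suc (Z M)) / 2 ^ M - real N < rat_of_code j"
    by (auto simp: add_divide_distrib)
  then have "accepted g N k M (Z M)"
    unfolding accepted_def using assms(1)
    by (intro exI[of _ i] exI[of _ j] exI[of _ w] conjI) (auto simp: M_def)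
  define m where "m = (LEAST m. accepted g N k m (Z m))"
  have acc: "accepted g N k m (Z m)"
    unfolding m_def using \<open>accepted g N k M (Z M)\<close> by (rule LeastI)
  then have "m \<noteq> 0"
    by (auto simp: accepted_def)
  then obtain m' where m': "m = Suc m'"
    by (cases m) auto
  have "\<not> accepted g N k m' (Z m')"
    using not_less_Least[of m' "\<lambda>m. accepted g N k m (Z m)"] m' unfolding m_def by auto
  moreover have "Z m' = Z m div 2"
    using mem_dyadic_div[of t N m' 1 "Z m"] Z[of m] Z[of m'] m' by (simp add: mem_dyadic_iff)
  ultimately have "selected g N k m (Z m)"
    using acc m' by (simp add: selected_def)
  then show ?thesis
    using that Z by blast
qed

section \<open>Total length of the selected intervals\<close>

lemma dyadic_sets: "dyadic N m z \<in> sets lebesgue"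
  by (simp add: dyadic_def)

lemma emeasure_dyadic: "emeasure lebesgue (dyadic N m z) = ennreal ((1 / 2) ^ m)"
proof -
  have "(real z + 1) / 2 ^ m - real N - (real z / 2 ^ m - real N) = (1 / 2) ^ m"
    by (simp add: add_divide_distrib power_one_over)
  moreover have "real z / 2 ^ m - real N \<le> (real z + 1) / 2 ^ m - real N"
    by (simp add: divide_right_mono)
  ultimately show ?thesis
    by (simp add: dyadic_def)
qed

text \<open>The selected cells are pairwise disjoint subsets of \<open>V\<close>, so their lengths
  add up to at most the measure of \<open>V\<close>.\<close>

lemma sum_selected_le:
  assumes "finite F" "\<And>m z. (m, z) \<in> F \<Longrightarrow> selected g N k m z"
    and "emeasure lebesgue V \<le> ennreal ((1 / 2) ^ k)" "V \<in> sets lebesgue"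
    and "\<And>i j w. g [w, k, i, j] = 0 \<Longrightarrow> {rat_of_code i <..< rat_of_code j} \<subseteq> V"
  shows "(\<Sum>(m, z)\<in>F. (1 / 2) ^ m) \<le> (1 / 2 :: real) ^ k"
proof -
  let ?D = "\<lambda>(m, z). dyadic N m z"
  have sub: "dyadic N m z \<subseteq> V" if mz: "(m, z) \<in> F" for m z
  proof -
    obtain i j w where *: "g [w, k, i, j] = 0" "rat_of_code i < real z / 2 ^ m - real N"
        "real (Suc z) / 2 ^ m - real N < rat_of_code j"
      using assms(2)[OF mz] unfolding selected_def accepted_def by blast
    then have "dyadic N m z \<subseteq> {rat_of_code i <..< rat_of_code j}"
      by (auto simp: dyadic_def add.commute)
    with assms(5)[OF *(1)] show ?thesis
      by blast
  qed
  have "disjoint_family_on ?D F"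
    unfolding disjoint_family_on_def using assms(2) selected_unique by fast
  then have "(\<Sum>p\<in>F. emeasure lebesgue (?D p)) = emeasure lebesgue (\<Union>p\<in>F. ?D p)"
    by (intro sum_emeasure assms(1)) (auto simp: dyadic_sets)
  also have "\<dots> \<le> emeasure lebesgue V"
    by (intro emeasure_mono assms(4)) (use sub in auto)
  also note assms(3)
  also have "(\<Sum>p\<in>F. emeasure lebesgue (?D p)) = (\<Sum>p\<in>F. ennreal (case p of (m, z) \<Rightarrow> (1 / 2) ^ m))"
    by (intro sum.cong) (auto simp: emeasure_dyadic)
  also have "\<dots> = ennreal (\<Sum>(m, z)\<in>F. (1 / 2) ^ m)"
    by (rule sum_ennreal) auto
  finally show ?thesis
    by (simp add: ennreal_le_iff)
qed

section \<open>Tents over dyadic intervals\<close>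

text \<open>The peak is at the left endpoint of the cell and the right foot a full cell beyond its
  right endpoint. This keeps the value above 1/2 on the cell while the support is only three cells
  long.\<close>

definition tent :: "nat \<Rightarrow> nat \<Rightarrow> nat \<Rightarrow> (real \<times> real) list" where
  "tent N m z = [((real z - 1) / 2 ^ m - real N, 0), (real z / 2 ^ m - real N, 1),
     ((real z + 2) / 2 ^ m - real N, 0)]"

lemma pl_vertices_tent: "pl_vertices (tent N m z)"
  by (simp add: pl_vertices_def tent_def divide_strict_right_mono)

text \<open>In the coordinate \<open>u\<close> a cell has length 1 and the peak is at 0, so the
  shape no longer depends on \<open>N\<close>, \<open>m\<close> and \<open>z\<close>.\<close>

lemma pl_fun_tent:
  "pl_fun (tent N m z) t = (let u = (t + real N) * 2 ^ m - real z in
     if -1 \<le> u \<and> u \<le> 0 then u + 1 else if 0 \<le> u \<and> u \<le> 2 then 1 - u / 2 else 0)"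
proof -
  define u where "u = (t + real N) * 2 ^ m - real z"
  have "(real z - 1) / 2 ^ m - real N \<le> t \<longleftrightarrow> -1 \<le> u" "t \<le> real z / 2 ^ m - real N \<longleftrightarrow> u \<le> 0"
    "real z / 2 ^ m - real N \<le> t \<longleftrightarrow> 0 \<le> u" "t \<le> (real z + 2) / 2 ^ m - real N \<longleftrightarrow> u \<le> 2"
    by (auto simp: u_def field_simps)
  moreover have "real z / 2 ^ m - real N - ((real z - 1) / 2 ^ m - real N) = 1 / 2 ^ m"
    "(real z + 2) / 2 ^ m - real N - (real z / 2 ^ m - real N) = 2 / 2 ^ m"
    by (simp_all add: diff_divide_distrib add_divide_distrib)
  moreover have "t - ((real z - 1) / 2 ^ m - real N) = (u + 1) / 2 ^ m"
    "t - (real z / 2 ^ m - real N) = u / 2 ^ m"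
    by (simp_all add: u_def field_simps)
  ultimately show ?thesis
    by (simp only: tent_def pl_fun.simps Let_def u_def[symmetric]) simp
qed

lemma pl_fun_tent_measurable: "pl_fun (tent N m z) \<in> borel_measurable lebesgue"
proof -
  have "pl_fun (tent N m z) \<in> borel_measurable borel"
    unfolding pl_fun_tent[abs_def] Let_def by measurable
  then show ?thesis
    by (simp add: measurable_completion)
qed

lemma pl_fun_tent_bounds:
  "0 \<le> pl_fun (tent N m z) t"
  "pl_fun (tent N m z) t \<le> indicator {(real z - 1) / 2 ^ m - real N .. (real z + 2) / 2 ^ m - real N} t"
proof -
  have "t \<in> {(real z - 1) / 2 ^ m - real N .. (real z + 2) / 2 ^ m - real N} \<longleftrightarrow>
      (t + real N) * 2 ^ m - real z \<in> {-1..2}"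
    by (auto simp: field_simps)
  then show "0 \<le> pl_fun (tent N m z) t" "pl_fun (tent N m z) t \<le>
      indicator {(real z - 1) / 2 ^ m - real N .. (real z + 2) / 2 ^ m - real N} t"
    unfolding pl_fun_tent indicator_def by (auto simp: Let_def)
qed

lemma pl_fun_tent_ge:
  assumes "t \<in> dyadic N m z"
  shows "1 / 2 \<le> pl_fun (tent N m z) t"
proof -
  have "(t + real N) * 2 ^ m - real z \<in> {0..<1}"
    using assms by (auto simp: dyadic_def field_simps)
  then show ?thesis
    unfolding pl_fun_tent by (auto simp: Let_def)
qed

text \<open>The shift by \<open>N\<close> is absorbed into numerators over \<open>2 ^ m\<close>.
  \<open>rat_of_code\<close> adds 1 to the second component, hence \<open>2 ^ m - 1\<close>. The
  left foot has \<open>Suc\<close> on the subtracted side since \<open>z - 1\<close> would be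
  truncated at \<open>z = 0\<close>. The codes \<open>0\<close> and
  \<open>prod_encode (2, 0)\<close> give the heights 0 and 1.\<close>

definition tent_code :: "nat \<Rightarrow> nat \<Rightarrow> nat \<Rightarrow> nat" where
  "tent_code N m z = list_encode
     [prod_encode (prod_encode (int_encode (int z - int (Suc (N * 2 ^ m))), 2 ^ m - 1), 0),
      prod_encode (prod_encode (int_encode (int z - int (N * 2 ^ m)), 2 ^ m - 1), prod_encode (2, 0)),
      prod_encode (prod_encode (int_encode (int (z + 2) - int (N * 2 ^ m)), 2 ^ m - 1), 0)]"

lemma vertices_of_tent_code: "vertices_of_code (tent_code N m z) = tent N m z"
proof -
  have R: "rat_of_code (prod_encode (int_encode (int a - int b), 2 ^ m - 1)) = (real a - real b) / 2 ^ m"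
    for a b
    by (simp add: rat_of_code_def)
  have 0: "rat_of_code 0 = 0"
    by (simp add: rat_of_code_def prod_decode_def prod_decode_aux.simps int_decode_def sum_decode_def)
  have 1: "rat_of_code (prod_encode (2, 0)) = 1"
    by (simp add: rat_of_code_def int_decode_def sum_decode_def)
  show ?thesis
    unfolding tent_code_def vertices_of_code_def tent_def
    by (simp only: list_encode_inverse list.map o_apply prod_encode_inverse map_prod_simp R 0 1)
      (simp add: field_simps)
qed

lemma computable_tent_code:
  assumes "computable n m" "computable n z"
  shows "computable n (\<lambda>xs. tent_code N (m xs) (z xs))"
  unfolding tent_code_def list_encode.simps
  by (intro computable_prod_encode computable_intros computable_int_encode_diff assms)

section \<open>The approximating sequence and its failure at \<open>x\<close>\<close>

theorem theorem4p7:
  fixes x :: real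
  assumes "\<not> martin_lof_random x"
  shows "\<exists>f s. weakly_L1_computable_via s f \<and>
           \<not> (\<exists>L. (\<lambda>n. s n x) \<longlonglongrightarrow> L \<and> ((\<lambda>y. poisson_integral f x y) \<longlongrightarrow> L) (at_right 0))"
proof -
  obtain V where V: "martin_lof_test V" "\<And>k. x \<in> V k"
    using assms unfolding martin_lof_random_def by blast
  obtain R where R: "Sigma01 3 R"
      "\<And>k. V k = \<Union> {{rat_of_code i <..< rat_of_code j} | i j. R [k, i, j]}"
    using V(1) unfolding martin_lof_test_def uniformly_effectively_open_def by blast
  obtain g where "recursive (Suc 3) g" and
      gR: "\<And>xs. length xs = 3 \<Longrightarrow> R xs \<longleftrightarrow> (\<exists>m. g (m # xs) = 0)"
    using R(1) unfolding Sigma01_def by blast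
  then have g: "computable 4 g"
    by (simp add: computable_recursive)
  have gV: "V k = \<Union> {{rat_of_code i <..< rat_of_code j} | i j. \<exists>w. g [w, k, i, j] = 0}" for k
    by (simp add: R(2) gR)
  have V_sets: "V k \<in> sets lebesgue" for k
  proof -
    have "open (V k)"
      unfolding R(2) by (rule open_Union) auto
    then show ?thesis
      by auto
  qed
  obtain N :: nat where N: "0 \<le> x + real N"
  proof -
    obtain N :: nat where "- x \<le> real N"
      using real_arch_simple by blast
    then show ?thesis
      by (intro that[of N]) simp
  qed

  \<comment> \<open>Every index codes a triple of test index, level and position. Triples that are
    not selected contribute the zero function, through the empty vertex list coded by
    \<open>0\<close>.\<close>
  define K where "K n = fst (prod_decode n)" for n
  define M where "M n = fst (prod_decode (snd (prod_decode n)))" for n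
  define Z where "Z n = snd (prod_decode (snd (prod_decode n)))" for n
  define S where "S n \<longleftrightarrow> selected g N (K n) (M n) (Z n)" for n
  define c where "c n = (if S n then tent_code N (M n) (Z n) else 0)" for n
  define s where "s n = pl_fun (vertices_of_code (c n))" for n
  define len where "len n = (if S n then (1 / 2) ^ M n else 0 :: real)" for n
  \<comment> \<open>The support of the tent, three cells long; hence the factor 3 in its
    measure.\<close>
  define A where "A n = (if S n then {(real (Z n) - 1) / 2 ^ M n - real N ..
      (real (Z n) + 2) / 2 ^ M n - real N} else {})" for n

  have code0: "vertices_of_code 0 = []"
    by (simp add: vertices_of_code_def list_decode.simps)
  have s_eq: "s n = (if S n then pl_fun (tent N (M n) (Z n)) else (\<lambda>_. 0))" for n
    by (auto simp: s_def c_def vertices_of_tent_code code0)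
  have s_bounds: "0 \<le> s n t" "s n t \<le> indicator (A n) t" for n t
    using pl_fun_tent_bounds by (auto simp: s_eq A_def)
  have s_meas [measurable]: "s n \<in> borel_measurable lebesgue" for n
    by (simp add: s_eq pl_fun_tent_measurable)

  have A_sets [measurable]: "A n \<in> sets lebesgue" for n
    by (simp add: A_def)
  have A_eq: "emeasure lebesgue (A n) = ennreal (3 * len n)" for n
  proof -
    have "(real (Z n) + 2) / 2 ^ M n - real N - ((real (Z n) - 1) / 2 ^ M n - real N) = 3 * (1 / 2) ^ M n"
      by (simp add: field_simps power_one_over)
    moreover have "(real (Z n) - 1) / 2 ^ M n - real N \<le> (real (Z n) + 2) / 2 ^ M n - real N"
      by (simp add: divide_right_mono)
    ultimately show ?thesis
      by (simp add: A_def len_def)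
  qed
  have len_nonneg: "0 \<le> len n" for n
    by (simp add: len_def)
  have A_measure: "measure lebesgue (A n) = 3 * len n" for n
    by (simp add: measure_def A_eq len_nonneg)

  have "summable len"
  proof (rule summableI_nonneg_bounded[OF len_nonneg])
    fix n
    \<comment> \<open>The test index never exceeds the index that codes it, so grouping by
      \<open>K\<close> needs only the groups \<open>k < n\<close>.\<close>
    have "(\<Sum>l<n. len l) = (\<Sum>k<n. \<Sum>l | l < n \<and> K l = k. len l)"
    proof -
      have "K l \<le> l" for l
        unfolding K_def by (metis le_prod_encode_1 prod.collapse prod_decode_inverse)
      then have "K ` {..<n} \<subseteq> {..<n}"
        by (auto intro: le_less_trans)
      then show ?thesis
        using sum.group[of "{..<n}" "{..<n}" K len] by simp
    qed
    also have "\<dots> \<le> (\<Sum>k<n. (1 / 2) ^ k)"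
    proof (rule sum_mono)
      fix k
      let ?I = "{l. l < n \<and> K l = k \<and> S l}"
      \<comment> \<open>Within a group the test index is fixed, so level and position recover the
        index and no cell is counted twice.\<close>
      have inj: "inj_on (\<lambda>l. (M l, Z l)) ?I"
      proof (rule inj_onI)
        fix l l' assume "l \<in> ?I" "l' \<in> ?I" "(M l, Z l) = (M l', Z l')"
        then have "K l = K l'" "M l = M l'" "Z l = Z l'"
          by auto
        then have "prod_decode l = prod_decode l'"
          unfolding K_def M_def Z_def by (metis prod.collapse prod_decode_inverse)
        then show "l = l'"
          by simp
      qed
      have "(\<Sum>l | l < n \<and> K l = k. len l) = (\<Sum>l\<in>?I. (1 / 2) ^ M l)"
        by (rule sum.mono_neutral_cong_right) (auto simp: len_def)
      also have "\<dots> = (\<Sum>(m, z)\<in>(\<lambda>l. (M l, Z l)) ` ?I. (1 / 2) ^ m)"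
        by (subst sum.reindex[OF inj]) simp
      also have "\<dots> \<le> (1 / 2) ^ k"
      proof (rule sum_selected_le)
        show "emeasure lebesgue (V k) \<le> ennreal ((1 / 2) ^ k)"
          using V(1) by (simp add: martin_lof_test_def)
        show "{rat_of_code i <..< rat_of_code j} \<subseteq> V k" if "g [w, k, i, j] = 0" for i j w
          unfolding gV using that by blast
      qed (auto simp: S_def V_sets)
      finally show "(\<Sum>l | l < n \<and> K l = k. len l) \<le> (1 / 2) ^ k" .
    qed
    also have "\<dots> \<le> 2"
      using sum_le_suminf[of "\<lambda>k. (1 / 2 :: real) ^ k" "{..<n}"] suminf_geometric[of "1 / 2 :: real"]
      by (simp add: summable_geometric)
    finally show "(\<Sum>l<n. len l) \<le> 2" .
  qed

  have AE0: "AE t in lebesgue. (\<lambda>n. s n t) \<longlonglongrightarrow> 0"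
  proof -
    have "AE t in lebesgue. eventually (\<lambda>n. t \<in> space lebesgue - A n) sequentially"
      by (rule borel_cantelli_AE1) (auto simp: A_eq A_measure intro: summable_mult \<open>summable len\<close>)
    then show ?thesis
    proof eventually_elim
      case (elim t)
      \<comment> \<open>Outside \<open>A n\<close> the two bounds in \<open>s_bounds\<close> squeeze
        \<open>s n t\<close> to 0.\<close>
      then have "eventually (\<lambda>n. s n t = 0) sequentially"
      proof eventually_elim
        case (elim n)
        then show ?case
          using s_bounds[of n t] by (simp add: indicator_def)
      qed
      then show ?case
        by (rule tendsto_eventually)
    qed
  qed

  have A_int: "integrable lebesgue (indicator (A n) :: real \<Rightarrow> real)" for n
    by (simp add: A_eq)
  have s_int: "integrable lebesgue (s n)" for n
    by (rule Bochner_Integration.integrable_bound[OF A_int[of n]]) (use s_bounds in auto)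
  have s_int_le: "(LINT t|lebesgue. s n t) \<le> 3 * len n" for n
    using integral_mono[OF s_int A_int s_bounds(2)] by (simp add: A_measure)
  have "summable (\<lambda>n. LINT t|lebesgue. \<bar>s n t - s (Suc n) t\<bar>)"
  proof (rule summable_comparison_test')
    show "summable (\<lambda>n. 3 * len n + 3 * len (Suc n))"
      using \<open>summable len\<close> by (intro summable_add summable_mult) (simp_all add: summable_Suc_iff)
    fix n
    \<comment> \<open>No cancellation is exploited: both functions are nonnegative, so their sum
      dominates the absolute difference.\<close>
    have "(LINT t|lebesgue. \<bar>s n t - s (Suc n) t\<bar>) \<le> (LINT t|lebesgue. s n t + s (Suc n) t)"
      by (intro integral_mono integrable_abs Bochner_Integration.integrable_diff
          Bochner_Integration.integrable_add s_int) (use s_bounds(1) in \<open>smt (verit)\<close>)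
    also have "\<dots> \<le> 3 * len n + 3 * len (Suc n)"
      using s_int_le[of n] s_int_le[of "Suc n"] by (simp add: s_int)
    finally show "norm (LINT t|lebesgue. \<bar>s n t - s (Suc n) t\<bar>) \<le> 3 * len n + 3 * len (Suc n)"
      by simp
  qed

  have "computable_pl_sequence s"
  proof -
    have "computable 1 (\<lambda>xs. c (xs ! 0))"
      unfolding c_def S_def K_def M_def Z_def
      by (intro computable_intros decidable_selected g computable_tent_code
          computable_fst_prod_decode computable_snd_prod_decode) auto
    then obtain c' where "recursive 1 c'" "\<And>xs. length xs = 1 \<Longrightarrow> c (xs ! 0) = c' xs"
      unfolding computable_def by blast
    moreover from this(2)[of "[n]" for n] have "c' [n] = c n" for n
      by simp
    moreover have "pl_vertices (vertices_of_code (c n))" for n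
      using pl_vertices_tent by (simp add: c_def vertices_of_tent_code code0 pl_vertices_def)
    ultimately show ?thesis
      unfolding computable_pl_sequence_def s_def by metis
  qed

  have "weakly_L1_computable_via s (\<lambda>_. 0)"
    unfolding weakly_L1_computable_via_def
    using \<open>computable_pl_sequence s\<close> AE0 \<open>summable (\<lambda>n. LINT t|lebesgue. \<bar>s n t - s (Suc n) t\<bar>)\<close>
    by simp
  \<comment> \<open>The Poisson integral of the zero function is constantly 0 and limits are unique,
    so only \<open>L = 0\<close> remains to be excluded.\<close>
  moreover have "L = 0" if "((\<lambda>y. poisson_integral (\<lambda>_. 0) x y) \<longlongrightarrow> L) (at_right 0)" for L
    using that tendsto_const_iff[of "at_right (0 :: real)" 0 L] by (simp add: poisson_integral_def)
  moreover have "\<not> (\<lambda>n. s n x) \<longlonglongrightarrow> 0"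
  proof
    assume "(\<lambda>n. s n x) \<longlonglongrightarrow> 0"
    then have "eventually (\<lambda>n. s n x < 1 / 2) sequentially"
      by (rule order_tendstoD) simp
    \<comment> \<open>The threshold \<open>k\<close> doubles as test index: \<open>x\<close> lies in
      \<open>V k\<close>, and the tent over its selected cell there has index
      \<open>prod_encode (k, prod_encode (m, z))\<close>, which is at least
      \<open>k\<close>.\<close>
    then obtain k where k: "\<And>n. n \<ge> k \<Longrightarrow> s n x < 1 / 2"
      unfolding eventually_sequentially by blast
    obtain i j w where "g [w, k, i, j] = 0" "x \<in> {rat_of_code i <..< rat_of_code j}"
      using V(2)[of k] unfolding gV by blast
    then obtain m z where mz: "selected g N k m z" "x \<in> dyadic N m z"
      using selected_cover N by blast
    define n where "n = prod_encode (k, prod_encode (m, z))"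
    have "s n x = pl_fun (tent N m z) x"
      using mz(1) by (simp add: s_eq S_def K_def M_def Z_def n_def)
    then show False
      using k[of n] pl_fun_tent_ge[OF mz(2)] le_prod_encode_1[of k "prod_encode (m, z)"]
      by (simp add: n_def)
  qed
  ultimately show ?thesis
    by blast
qed

end
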